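(* Let $f_\theta$ be a neural network with parameter $\theta$ and let $\mathcal{H}$ be the reproducing kernel Hilbert space induced by the Neural Tangent Kernel $\Theta$ of $f_\theta$. Then $$\mathcal{M}_1=\widetilde{\mathcal{E}}(\alpha,f_\theta),\qquad\text{and}\qquad \|\nabla_{f_\theta}\mathcal{L}_m(f_\theta)\|_{\mathcal{H}}^2=\|\nabla_\theta\mathcal{L}_m(f_\theta)\|^2 .$$
   Context: Parameters and parameter gradients are row vectors. The Neural Tangent Kernel of $f_\theta$ is $\Theta(x_1,x_2)=\frac{\partial f_\theta(x_1)}{\partial\theta}\frac{\partial f_\theta(x_2)}{\partial\theta}^{\intercal}$. For a functional $\mathcal{F}$ on $\mathcal{H}$, $\nabla_f\mathcal{F}(f)\in\mathcal{H}$ denotes its functional gradient: $\langle\nabla_f\mathcal{F}(f),g\rangle_{\mathcal{H}}=\lim_{\epsilon\to0}\frac{\mathcal{F}(f+\epsilon g)-\mathcal{F}(f)}{\epsilon}$ for $g\in\mathcal{H}$; $\|\cdot\|_{\mathcal{H}}$ is the norm of $\mathcal{H}$. $\mathcal{T}_m$ is a random task. $\mathcal{L}_m(f)$ is the expected loss of task $\mathcal{T}_m$, $\mathcal{L}_m(f)=\mathbb{E}_{(x_m,y_m)}[C(f(x_m),y_m)]$, with $(x_m,y_m)$ drawn from the data distribution of the task and $C$ the per-sample loss; e.g. for regression $C(f(x),y)=\frac12\|f(x)-y\|^2$. For a hyper-parameter $\alpha$ the regularized energy functional is $\widetilde{\mathcal{E}}(\alpha,f_\theta)=\mathbb{E}_{\mathcal{T}_m}\big[\mathcal{L}_m(f_\theta)-\alpha\|\nabla_{f_\theta}\mathcal{L}_m(f_\theta)\|_{\mathcal{H}}^2\big]$.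 With $\alpha$ also the inner-loop learning rate, $\mathcal{M}_k=\mathbb{E}_{\mathcal{T}_m}\big[\mathcal{L}_m(f_\theta)-\sum_{i=0}^{k-1}\beta_i\big]$ where $\beta_i=\alpha\nabla_{\theta_i}\mathcal{L}_m(f_{\theta_i})\nabla_\theta\mathcal{L}_m(f_\theta)^{\intercal}$, $\theta_0=\theta$; in particular $\mathcal{M}_1=\mathbb{E}_{\mathcal{T}_m}[\mathcal{L}_m(f_\theta)]-\alpha\,\mathbb{E}_{\mathcal{T}_m}[\|\nabla_\theta\mathcal{L}_m(f_\theta)\|^2]$.
   Formalization: Added regularity: f is differentiable in θ at the given θ, C is differentiable at f_θ(x), the loss is integrable, and its increments in θ and along each g in H are dominated by an integrable bound times the distance; without such conditions the gradients of L_m may fail to exist. *)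

theory Defs
  imports "HOL-Probability.Probability"
begin

section \<open>Reproducing kernel Hilbert spaces\<close>

text \<open>
  The kernel is matrix-valued, because the network may have several outputs. An RKHS is a set of
  functions \<open>H\<close> together with an inner product \<open>ip\<close>, of which only the values
  on \<open>H\<close> are meaningful.
\<close>

definition hnorm :: "(('x \<Rightarrow> real^'d) \<Rightarrow> ('x \<Rightarrow> real^'d) \<Rightarrow> real) \<Rightarrow> ('x \<Rightarrow> real^'d) \<Rightarrow> real" where
  "hnorm ip g = sqrt (ip g g)"

locale rkhs =
  fixes K :: "'x \<Rightarrow> 'x \<Rightarrow> real^'d^'d"
    and H :: "('x \<Rightarrow> real^'d) set"
    and ip :: "('x \<Rightarrow> real^'d) \<Rightarrow> ('x \<Rightarrow> real^'d) \<Rightarrow> real"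
  assumes zero_in: "(\<lambda>x. 0) \<in> H"
    and add_in: "\<lbrakk>g \<in> H; h \<in> H\<rbrakk> \<Longrightarrow> (\<lambda>x. g x + h x) \<in> H"
    and scale_in: "g \<in> H \<Longrightarrow> (\<lambda>x. c *\<^sub>R g x) \<in> H"
    and ip_add: "\<lbrakk>g \<in> H; g' \<in> H; h \<in> H\<rbrakk> \<Longrightarrow> ip (\<lambda>x. g x + g' x) h = ip g h + ip g' h"
    and ip_scale: "\<lbrakk>g \<in> H; h \<in> H\<rbrakk> \<Longrightarrow> ip (\<lambda>x. c *\<^sub>R g x) h = c * ip g h"
    and ip_commute: "\<lbrakk>g \<in> H; h \<in> H\<rbrakk> \<Longrightarrow> ip g h = ip h g"
    and ip_nonneg: "g \<in> H \<Longrightarrow> 0 \<le> ip g g"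
    and ip_definite: "\<lbrakk>g \<in> H; ip g g = 0\<rbrakk> \<Longrightarrow> g = (\<lambda>x. 0)"
    and complete: "Metric_space.mcomplete H (\<lambda>g h. hnorm ip (\<lambda>x. g x - h x))"
    and kernel_in: "(\<lambda>x'. K x' x *v v) \<in> H"
    and reproducing: "g \<in> H \<Longrightarrow> ip g (\<lambda>x'. K x' x *v v) = g x \<bullet> v"

section \<open>Functional gradient\<close>

text \<open>
  The functional is a map on all functions: the base point \<open>f\<close> is a network and need not be an
  element of \<open>H\<close>; only the directions and the gradient are.
\<close>

definition has_functional_gradient ::
  "('x \<Rightarrow> real^'d) set \<Rightarrow> (('x \<Rightarrow> real^'d) \<Rightarrow> ('x \<Rightarrow> real^'d) \<Rightarrow> real) \<Rightarrow>
   (('x \<Rightarrow> real^'d) \<Rightarrow> real) \<Rightarrow> ('x \<Rightarrow> real^'d) \<Rightarrow> ('x \<Rightarrow> real^'d) \<Rightarrow> bool" where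
  "has_functional_gradient H ip F f G \<longleftrightarrow>
     G \<in> H \<and>
     (\<forall>g\<in>H. ((\<lambda>\<epsilon>. (F (\<lambda>x. f x + \<epsilon> *\<^sub>R g x) - F f) / \<epsilon>) \<longlongrightarrow> ip G g) (at 0))"

definition functional_gradient ::
  "('x \<Rightarrow> real^'d) set \<Rightarrow> (('x \<Rightarrow> real^'d) \<Rightarrow> ('x \<Rightarrow> real^'d) \<Rightarrow> real) \<Rightarrow>
   (('x \<Rightarrow> real^'d) \<Rightarrow> real) \<Rightarrow> ('x \<Rightarrow> real^'d) \<Rightarrow> ('x \<Rightarrow> real^'d)" where
  "functional_gradient H ip F f = (THE G. has_functional_gradient H ip F f G)"

lemma (in rkhs) functional_gradient_eqI:
  assumes "has_functional_gradient H ip F f G"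
  shows "functional_gradient H ip F f = G"
  unfolding functional_gradient_def
proof (rule the_equality)
  show "has_functional_gradient H ip F f G" by fact
next
  fix G' assume G': "has_functional_gradient H ip F f G'"
  have in_H: "G \<in> H" "G' \<in> H"
    using assms G' by (auto simp: has_functional_gradient_def)
  have eq: "ip G' g = ip G g" if "g \<in> H" for g
    using that assms G' unfolding has_functional_gradient_def
    by (meson at_neq_bot tendsto_unique)
  let ?n = "\<lambda>x. (-1) *\<^sub>R G x"
  let ?D = "\<lambda>x. G' x + (-1) *\<^sub>R G x"
  have n: "?n \<in> H" using scale_in in_H by blast
  have D: "?D \<in> H" using add_in[OF in_H(2) n] by simp
  have "ip ?D ?D = ip G' ?D + ip ?n ?D"
    using ip_add[OF in_H(2) n D] by simp
  also have "\<dots> = ip G' ?D + (-1) * ip G ?D"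
    using ip_scale[OF in_H(1) D, of "-1"] by simp
  also have "\<dots> = 0" using eq[OF D] by simp
  finally have "?D = (\<lambda>x. 0)" using ip_definite[OF D] by blast
  then show "G' = G" by (auto simp: fun_eq_iff)
qed

section \<open>Parametrized functions and the Neural Tangent Kernel\<close>

definition param_jacobian :: "(real^'p \<Rightarrow> 'x \<Rightarrow> real^'d) \<Rightarrow> real^'p \<Rightarrow> 'x \<Rightarrow> real^'p^'d" where
  "param_jacobian f \<theta> x = jacobian (\<lambda>\<theta>'. f \<theta>' x) (at \<theta>)"

definition ntk :: "(real^'p \<Rightarrow> 'x \<Rightarrow> real^'d) \<Rightarrow> real^'p \<Rightarrow> 'x \<Rightarrow> 'x \<Rightarrow> real^'d^'d" where
  "ntk f \<theta> x\<^sub>1 x\<^sub>2 = param_jacobian f \<theta> x\<^sub>1 ** transpose (param_jacobian f \<theta> x\<^sub>2)"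

definition param_gradient :: "(real^'p \<Rightarrow> real) \<Rightarrow> real^'p \<Rightarrow> real^'p" where
  "param_gradient J \<theta> = (THE D. GDERIV J \<theta> :> D)"

lemma param_gradient_eqI: "GDERIV J \<theta> :> D \<Longrightarrow> param_gradient J \<theta> = D"
  unfolding param_gradient_def
  by (rule the_equality, assumption)
    (metis (no_types) gderiv_def has_derivative_unique inner_commute vector_eq_ldot)

section \<open>Task losses and meta-learning objectives\<close>

definition expected_loss ::
  "(real^'d \<Rightarrow> 'y \<Rightarrow> real) \<Rightarrow> ('x \<times> 'y) measure \<Rightarrow> ('x \<Rightarrow> real^'d) \<Rightarrow> real" where
  "expected_loss C D h = (LINT (x, y)|D. C (h x) y)"

text \<open>
  In the following, \<open>T\<close> is the distribution of the random task and \<open>L m\<close> the expected loss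
  of task \<open>m\<close>.
\<close>

definition regularized_energy ::
  "'m measure \<Rightarrow> ('m \<Rightarrow> ('x \<Rightarrow> real^'d) \<Rightarrow> real) \<Rightarrow>
   ('x \<Rightarrow> real^'d) set \<Rightarrow> (('x \<Rightarrow> real^'d) \<Rightarrow> ('x \<Rightarrow> real^'d) \<Rightarrow> real) \<Rightarrow>
   real \<Rightarrow> ('x \<Rightarrow> real^'d) \<Rightarrow> real" where
  "regularized_energy T L H ip \<alpha> h =
     (LINT m|T. L m h - \<alpha> * (hnorm ip (functional_gradient H ip (L m) h))\<^sup>2)"

text \<open>The inner loop is plain gradient descent with learning rate \<open>\<alpha>\<close>.\<close>

primrec inner_iterate :: "real \<Rightarrow> (real^'p \<Rightarrow> real) \<Rightarrow> real^'p \<Rightarrow> nat \<Rightarrow> real^'p" where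
  "inner_iterate \<alpha> J \<theta> 0 = \<theta>"
| "inner_iterate \<alpha> J \<theta> (Suc i) =
     inner_iterate \<alpha> J \<theta> i - \<alpha> *\<^sub>R param_gradient J (inner_iterate \<alpha> J \<theta> i)"

definition loss_decrement :: "real \<Rightarrow> (real^'p \<Rightarrow> real) \<Rightarrow> real^'p \<Rightarrow> nat \<Rightarrow> real" where
  "loss_decrement \<alpha> J \<theta> i =
     \<alpha> * (param_gradient J (inner_iterate \<alpha> J \<theta> i) \<bullet> param_gradient J \<theta>)"

definition meta_objective ::
  "'m measure \<Rightarrow> ('m \<Rightarrow> ('x \<Rightarrow> real^'d) \<Rightarrow> real) \<Rightarrow> (real^'p \<Rightarrow> 'x \<Rightarrow> real^'d) \<Rightarrow>
   real \<Rightarrow> real^'p \<Rightarrow> nat \<Rightarrow> real" where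
  "meta_objective T L f \<alpha> \<theta> k =
     (LINT m|T. L m (f \<theta>) - (\<Sum>i<k. loss_decrement \<alpha> (\<lambda>\<theta>'. L m (f \<theta>')) \<theta> i))"

section \<open>Differentiation under the expectation\<close>

text \<open>
  The usual condition for exchanging derivative and expectation at a point \<open>p\<close>: near
  \<open>p\<close>, the increments of the integrand are bounded by an integrable multiple of the distance.
\<close>

definition dominated_increments_at ::
  "'z measure \<Rightarrow> ('p::metric_space \<Rightarrow> 'z \<Rightarrow> real) \<Rightarrow> 'p \<Rightarrow> bool" where
  "dominated_increments_at D F p \<longleftrightarrow>
     (\<exists>\<delta>>0. \<exists>B. integrable D B \<and>
        (\<forall>q\<in>ball p \<delta>. F q \<in> borel_measurable D \<and>
           (\<forall>z\<in>space D. \<bar>F q z - F p z\<bar> \<le> B z * dist q p)))"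

end

theory Submission
  imports Defs
begin

text \<open>
  The Neural Tangent Kernel factors as \<open>J(x) J(x')\<^sup>T\<close> through the Jacobian, so its RKHS
  consists of the functions \<open>x \<mapsto> J(x) w\<close>, and on the span \<open>W\<close> of the ranges
  of the \<open>J(x)\<^sup>T\<close> the map \<open>w \<mapsto> J(\<cdot>) w\<close> is an isometry. Write \<open>c\<close>
  for the gradient of the per-sample loss in its first argument. By the chain rule the parameter
  gradient is \<open>G = \<E>[J(x)\<^sup>T c(x, y)]\<close>, which lies in \<open>W\<close>; the derivative of the loss in
  direction \<open>J(\<cdot>) w\<close> is \<open>\<E>[c(x, y) \<bullet> J(x) w] = G \<bullet> w\<close>. Hence the functional gradient
  is \<open>J(\<cdot>) G\<close>, whose norm is that of \<open>G\<close>.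
\<close>

section \<open>Kernels with a finite-dimensional feature map\<close>

lemma inner_vector_matrix_mult_left:
  fixes A :: "real^'n^'m"
  shows "(v v* A) \<bullet> w = (A *v w) \<bullet> v"
  unfolding dot_lmul_matrix by (rule inner_commute)

text \<open>This is the orthogonal complement of the common null space of all \<open>J x\<close>, so
  \<open>u\<close> in it is determined by the function \<open>\<lambda>x. J x *v u\<close>.\<close>

definition feature_space :: "('x \<Rightarrow> real^'p^'d) \<Rightarrow> (real^'p) set" where
  "feature_space J = span (\<Union>x. range (\<lambda>v. transpose (J x) *v v))"

lemma transpose_in_feature_space: "transpose (J x) *v v \<in> feature_space J"
  unfolding feature_space_def by (rule span_base) auto

lemma subspace_feature_space: "subspace (feature_space J)"
  by (simp add: feature_space_def)

context rkhs
begin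

text \<open>Reduces claims about a span to its generators. Membership in \<open>H\<close> and the
  inner product formula are carried together because \<open>ip\<close> is additive only on
  \<open>H\<close>.\<close>

lemma subspace_feature_inner:
  fixes J :: "'x \<Rightarrow> real^'p^'d"
  assumes "h \<in> H"
  shows "subspace {u. (\<lambda>x. J x *v u) \<in> H \<and> ip (\<lambda>x. J x *v u) h = u \<bullet> w}"
proof -
  have "ip (\<lambda>x. 0) h = 0"
    using ip_scale[OF zero_in assms, of 0] by simp
  then show ?thesis
    using zero_in add_in scale_in ip_add[OF _ _ assms] ip_scale[OF _ assms]
    by (auto simp: subspace_def matrix_vector_right_distrib matrix_vector_mult_scaleR inner_add_left)
qed

text \<open>For a generator \<open>u = transpose (J x) *v v\<close> the function
  \<open>J(.) u\<close> is the kernel section at \<open>x\<close> in direction \<open>v\<close>, and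
  the reproducing property evaluates its inner product with \<open>J(.) w\<close> as
  \<open>(J x *v w) \<bullet> v = u \<bullet> w\<close>. Linearity extends this to the span. The
  vector \<open>w\<close> may lie outside the span.\<close>

lemma feature_map_in_and_inner:
  fixes J :: "'x \<Rightarrow> real^'p^'d"
  assumes K: "K = (\<lambda>x x'. J x ** transpose (J x'))"
    and u: "u \<in> feature_space J" and h: "(\<lambda>x. J x *v w) \<in> H"
  shows "(\<lambda>x. J x *v u) \<in> H \<and> ip (\<lambda>x. J x *v u) (\<lambda>x. J x *v w) = u \<bullet> w"
proof -
  have "(\<lambda>x'. J x' *v (transpose (J x) *v v)) \<in> H"
    and "ip (\<lambda>x'. J x' *v (transpose (J x) *v v)) (\<lambda>x. J x *v w)
      = (transpose (J x) *v v) \<bullet> w" for x v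
  proof -
    have *: "(\<lambda>x'. J x' *v (transpose (J x) *v v)) = (\<lambda>x'. K x' x *v v)"
      by (simp add: K matrix_vector_mul_assoc del: transpose_matrix_vector)
    show "(\<lambda>x'. J x' *v (transpose (J x) *v v)) \<in> H"
      unfolding * by (rule kernel_in)
    show "ip (\<lambda>x'. J x' *v (transpose (J x) *v v)) (\<lambda>x. J x *v w)
      = (transpose (J x) *v v) \<bullet> w"
      unfolding * using ip_commute[OF kernel_in h] reproducing[OF h]
      by (simp add: inner_vector_matrix_mult_left)
  qed
  then have "feature_space J \<subseteq>
      {u. (\<lambda>x. J x *v u) \<in> H \<and> ip (\<lambda>x. J x *v u) (\<lambda>x. J x *v w) = u \<bullet> w}"
    unfolding feature_space_def by (intro span_minimal subspace_feature_inner[OF h]) auto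
  then show ?thesis using u by auto
qed

lemma feature_map_in:
  fixes J :: "'x \<Rightarrow> real^'p^'d"
  assumes K: "K = (\<lambda>x x'. J x ** transpose (J x'))" and u: "u \<in> feature_space J"
  shows "(\<lambda>x. J x *v u) \<in> H"
  \<comment> \<open>With \<open>w = 0\<close> the condition on \<open>w\<close> is that the zero
    function is in \<open>H\<close>.\<close>
  using feature_map_in_and_inner[OF K u, of 0] zero_in by simp

text \<open>The functional \<open>u \<mapsto> ip (J(.) u) h\<close> on the feature space has a Riesz
  representer \<open>w\<close>. Testing it on kernel sections, the reproducing property yields
  \<open>h x \<bullet> v = (J x *v w) \<bullet> v\<close> for all \<open>x\<close> and
  \<open>v\<close>.\<close>

lemma feature_map_surj:
  fixes J :: "'x \<Rightarrow> real^'p^'d"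
  assumes K: "K = (\<lambda>x x'. J x ** transpose (J x'))" and h: "h \<in> H"
  obtains w where "h = (\<lambda>x. J x *v w)"
proof -
  obtain B where B: "B \<subseteq> feature_space J" "pairwise orthogonal B" "\<And>b. b \<in> B \<Longrightarrow> norm b = 1"
      "independent B" "span B = feature_space J"
    by (rule orthonormal_basis_subspace[of "feature_space J"]) (auto simp: feature_space_def)
  have fin: "finite B" using B(4) by (rule independent_imp_finite)
  \<comment> \<open>The Riesz representer, expanded in an orthonormal basis.\<close>
  define w where "w = (\<Sum>b\<in>B. ip (\<lambda>x. J x *v b) h *\<^sub>R b)"
  have "b \<bullet> w = ip (\<lambda>x. J x *v b) h" if b: "b \<in> B" for b
  proof -
    have "b \<bullet> w = (\<Sum>a\<in>B. ip (\<lambda>x. J x *v a) h * (b \<bullet> a))"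
      by (simp add: w_def inner_sum_right)
    also have "\<dots> = (\<Sum>a\<in>B. if a = b then ip (\<lambda>x. J x *v b) h else 0)"
    proof (rule sum.cong[OF refl])
      fix a assume "a \<in> B"
      then show "ip (\<lambda>x. J x *v a) h * (b \<bullet> a) = (if a = b then ip (\<lambda>x. J x *v b) h else 0)"
        using B(2) B(3)[OF b] b by (auto simp: pairwise_def orthogonal_def norm_eq_1)
    qed
    finally show ?thesis using fin b by simp
  qed
  then have "span B \<subseteq> {u. (\<lambda>x. J x *v u) \<in> H \<and> ip (\<lambda>x. J x *v u) h = u \<bullet> w}"
    using B(1) feature_map_in[OF K] by (intro span_minimal subspace_feature_inner[OF h]) auto
  then have w: "ip (\<lambda>x. J x *v u) h = u \<bullet> w" if "u \<in> feature_space J" for u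
    using that B(5) by auto
  have "h x \<bullet> v = (J x *v w) \<bullet> v" for x v
  proof -
    have "h x \<bullet> v = ip (\<lambda>x'. K x' x *v v) h"
      using reproducing[OF h] ip_commute[OF h kernel_in] by simp
    also have "\<dots> = (transpose (J x) *v v) \<bullet> w"
      using w[OF transpose_in_feature_space, of x v] by (simp add: K matrix_vector_mul_assoc del: transpose_matrix_vector)
    finally show ?thesis by (simp add: inner_vector_matrix_mult_left)
  qed
  then have "h = (\<lambda>x. J x *v w)" by (metis ext vector_eq_rdot)
  then show ?thesis by (rule that)
qed

end

section \<open>Differentiation under the integral sign\<close>

text \<open>The Leibniz rule. Measurability of \<open>A\<close> and the bound
  \<open>norm (A z) \<le> B z\<close> are inherited from difference quotients along each direction;
  dominated convergence then handles the normalized first-order remainder.\<close>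

lemma dominated_increments_gradient:
  fixes F :: "'a::euclidean_space \<Rightarrow> 'z \<Rightarrow> real"
  assumes dom: "dominated_increments_at D F p" and int: "integrable D (F p)"
    and grad: "\<And>z. z \<in> space D \<Longrightarrow> GDERIV (\<lambda>q. F q z) p :> A z"
  shows "integrable D A" and "GDERIV (\<lambda>q. LINT z|D. F q z) p :> (LINT z|D. A z)"
proof -
  obtain \<delta> B where \<delta>: "\<delta> > 0" and B: "integrable D B"
    and meas: "\<And>q. q \<in> ball p \<delta> \<Longrightarrow> F q \<in> borel_measurable D"
    and bd: "\<And>q z. \<lbrakk>q \<in> ball p \<delta>; z \<in> space D\<rbrakk> \<Longrightarrow> \<bar>F q z - F p z\<bar> \<le> B z * dist q p"
    using dom unfolding dominated_increments_at_def by blast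
  have dir: "(\<lambda>z. a \<bullet> A z) \<in> borel_measurable D \<and> (\<forall>z\<in>space D. \<bar>a \<bullet> A z\<bar> \<le> B z * norm a)" for a
  proof -
    \<comment> \<open>Steps chosen so that
      \<open>t n * norm a \<le> \<delta> / (n + 2) < \<delta>\<close>: the \<open>+ 1\<close> covers
      \<open>a = 0\<close>, and the \<open>+ 2\<close> makes the last inequality strict already at
      \<open>n = 0\<close>.\<close>
    define t where "t n = \<delta> / (norm a + 1) * (1 / (real n + 2))" for n
    have t_pos: "t n > 0" for n
      unfolding t_def using \<delta> by (intro mult_pos_pos divide_pos_pos) (auto simp: add_nonneg_pos)
    have t_ball: "p + t n *\<^sub>R a \<in> ball p \<delta>" for n
    proof -
      have "t n * norm a = \<delta> * (norm a / (norm a + 1)) * (1 / (real n + 2))"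
        by (simp add: t_def)
      also have "\<dots> \<le> \<delta> * 1 * (1 / (real n + 2))"
        using \<delta> by (intro mult_right_mono mult_left_mono) (auto simp: add_nonneg_pos divide_le_eq_1)
      also have "\<dots> < \<delta>" using \<delta> by (simp add: field_simps add_pos_nonneg)
      finally show ?thesis using t_pos[of n] by (simp add: dist_norm)
    qed
    have t_lim: "t \<longlonglongrightarrow> 0"
    proof -
      have "(\<lambda>n. 1 / (real n + 2)) \<longlonglongrightarrow> 0"
        using LIMSEQ_ignore_initial_segment[OF lim_inverse_n', of 2] by (simp add: add.commute)
      from tendsto_mult_left[OF this, of "\<delta> / (norm a + 1)"] show ?thesis
        by (simp add: t_def[abs_def])
    qed
    define Q where "Q n z = (F (p + t n *\<^sub>R a) z - F p z) / t n" for n z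
    have Q_lim: "(\<lambda>n. Q n z) \<longlonglongrightarrow> a \<bullet> A z" if z: "z \<in> space D" for z
    proof -
      \<comment> \<open>The base point is written as the value at 0 of the line through
        \<open>p\<close>, the form that the chain rule expects.\<close>
      have "((\<lambda>q. F q z) has_derivative (\<lambda>h. h \<bullet> A z)) (at (p + 0 *\<^sub>R a))"
        using grad[OF z] by (simp add: gderiv_def)
      moreover have "((\<lambda>s. p + s *\<^sub>R a) has_derivative (\<lambda>s. s *\<^sub>R a)) (at (0::real))"
        by (auto intro!: derivative_eq_intros)
      ultimately have "((\<lambda>s. F (p + s *\<^sub>R a) z) has_derivative (\<lambda>s. (s *\<^sub>R a) \<bullet> A z)) (at 0)"
        by (rule has_derivative_compose[rotated])
      then have "((\<lambda>s. F (p + s *\<^sub>R a) z) has_real_derivative (a \<bullet> A z)) (at 0)"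
        by (simp add: has_field_derivative_def mult_commute_abs)
      then have "((\<lambda>s. (F (p + s *\<^sub>R a) z - F p z) / s) \<longlongrightarrow> a \<bullet> A z) (at 0)"
        by (simp add: DERIV_def)
      moreover have "filterlim t (at 0) sequentially"
        using t_lim t_pos by (auto simp: filterlim_at less_imp_neq[THEN not_sym])
      ultimately show ?thesis
        unfolding Q_def by (rule filterlim_compose)
    qed
    have "(\<lambda>z. a \<bullet> A z) \<in> borel_measurable D"
    proof (rule borel_measurable_LIMSEQ_real)
      show "Q n \<in> borel_measurable D" for n
        unfolding Q_def using meas[OF t_ball] meas[of p] \<delta> by simp
    qed (rule Q_lim)
    moreover have "\<bar>a \<bullet> A z\<bar> \<le> B z * norm a" if z: "z \<in> space D" for z
    proof (rule LIMSEQ_le_const2[OF tendsto_rabs[OF Q_lim[OF z]]])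
      have "\<bar>Q n z\<bar> \<le> B z * norm a" for n
        using bd[OF t_ball z, of n] t_pos[of n] by (simp add: Q_def dist_norm divide_le_eq mult_ac)
      then show "\<exists>N. \<forall>n\<ge>N. \<bar>Q n z\<bar> \<le> B z * norm a" by blast
    qed
    ultimately show ?thesis by blast
  qed
  have A_meas: "A \<in> borel_measurable D"
    using dir by (subst borel_measurable_euclidean_space) (auto simp: inner_commute)
  have A_bd: "norm (A z) \<le> B z" if z: "z \<in> space D" for z
  proof (cases "A z = 0")
    case True
    \<comment> \<open>Here the goal is \<open>0 \<le> B z\<close>, which follows from the bound in
      any direction of norm 1.\<close>
    obtain b :: 'a where "b \<in> Basis" using nonempty_Basis by blast
    then show ?thesis using dir[of b] z True by force
  next
    case False
    have "norm (A z) * norm (A z) \<le> B z * norm (A z)"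
      using dir[of "A z"] z by (auto simp: dot_square_norm power2_eq_square)
    then show ?thesis using False by simp
  qed
  show A: "integrable D A"
    using A_bd by (intro Bochner_Integration.integrable_bound[OF B A_meas]) force
  have F_int: "integrable D (F q)" if q: "q \<in> ball p \<delta>" for q
  proof -
    have "integrable D (\<lambda>z. F q z - F p z)"
    proof (rule Bochner_Integration.integrable_bound[of D "\<lambda>z. B z * dist q p"])
      show "AE z in D. norm (F q z - F p z) \<le> norm (B z * dist q p)"
        using bd[OF q] by force
    qed (use B meas[OF q] meas[of p] \<delta> in auto)
    from Bochner_Integration.integrable_add[OF this int] show ?thesis by simp
  qed
  \<comment> \<open>Differentiability of the integral at \<open>p\<close> amounts to the integral of
    this normalized remainder tending to 0.\<close>
  define R where "R q z = (F q z - F p z - (q - p) \<bullet> A z) / norm (q - p)" for q z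
  have lim: "((\<lambda>q. LINT z|D. R q z) \<longlongrightarrow> 0) (at p)"
    unfolding tendsto_at_iff_sequentially comp_def
  proof (intro allI impI)
    fix X assume X: "\<forall>i. X i \<in> UNIV - {p}" and X_lim: "X \<longlonglongrightarrow> p"
    have "\<forall>\<^sub>F n in sequentially. X n \<in> ball p \<delta>"
      using X_lim \<delta> by (intro topological_tendstoD) auto
    \<comment> \<open>The domination holds only inside the ball, so the sequence is shifted to a
      tail that stays there.\<close>
    then obtain N where N: "\<And>n. X (n + N) \<in> ball p \<delta>"
      unfolding eventually_sequentially by (meson le_add2)
    have "(\<lambda>n. LINT z|D. R (X (n + N)) z) \<longlonglongrightarrow> (LINT z|D. 0)"
    \<comment> \<open>One \<open>B z\<close> bounds the increment of \<open>F\<close>, the other the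
      linear term \<open>(q - p) \<bullet> A z\<close>.\<close>
    proof (rule integral_dominated_convergence[where w = "\<lambda>z. 2 * B z"])
      show "R (X (n + N)) \<in> borel_measurable D" for n
        unfolding R_def using meas[OF N] meas[of p] A_meas \<delta> by simp
      show "AE z in D. (\<lambda>n. R (X (n + N)) z) \<longlonglongrightarrow> 0"
      proof (rule AE_I2)
        fix z assume z: "z \<in> space D"
        have "((\<lambda>q. norm (R q z)) \<longlongrightarrow> 0) (at p)"
          using grad[OF z] unfolding gderiv_def has_derivative_iff_norm R_def by simp
        then have "(\<lambda>n. R (X n) z) \<longlonglongrightarrow> 0"
          using X X_lim unfolding tendsto_at_iff_sequentially comp_def tendsto_norm_zero_iff by blast
        then show "(\<lambda>n. R (X (n + N)) z) \<longlonglongrightarrow> 0"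
          by (rule LIMSEQ_ignore_initial_segment)
      qed
      show "AE z in D. norm (R (X (n + N)) z) \<le> 2 * B z" for n
      proof (rule AE_I2)
        fix z assume z: "z \<in> space D"
        let ?q = "X (n + N)"
        have pos: "norm (?q - p) > 0" using X by simp
        have "\<bar>F ?q z - F p z - (?q - p) \<bullet> A z\<bar> \<le> 2 * B z * norm (?q - p)"
          using bd[OF N z, of n] dir[of "?q - p"] z by (force simp: dist_norm)
        then show "norm (R ?q z) \<le> 2 * B z"
          using pos by (simp add: R_def divide_le_eq)
      qed
    qed (use B in auto)
    then show "(\<lambda>n. LINT z|D. R (X n) z) \<longlonglongrightarrow> 0"
      by (auto dest: LIMSEQ_offset)
  qed
  have "\<forall>\<^sub>F q in at p. norm (LINT z|D. R q z) =
      norm ((LINT z|D. F q z) - (LINT z|D. F p z) - (q - p) \<bullet> (LINT z|D. A z)) / norm (q - p)"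
    unfolding eventually_at
  proof (intro exI conjI ballI impI)
    fix q assume q: "q \<noteq> p \<and> dist q p < \<delta>"
    then have "integrable D (F q)" by (intro F_int) (simp add: dist_commute)
    then show "norm (LINT z|D. R q z) =
      norm ((LINT z|D. F q z) - (LINT z|D. F p z) - (q - p) \<bullet> (LINT z|D. A z)) / norm (q - p)"
      using int A unfolding R_def by (simp add: integral_inner_right)
  qed (rule \<delta>)
  then have "((\<lambda>q. norm ((LINT z|D. F q z) - (LINT z|D. F p z) - (q - p) \<bullet> (LINT z|D. A z))
      / norm (q - p)) \<longlongrightarrow> 0) (at p)"
    using tendsto_norm_zero[OF lim] by (rule Lim_transform_eventually[rotated])
  then show "GDERIV (\<lambda>q. LINT z|D. F q z) p :> (LINT z|D. A z)"
    unfolding gderiv_def has_derivative_iff_norm by (simp add: bounded_linear_inner_left)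
qed

text \<open>The component \<open>w\<close> of the integral orthogonal to \<open>S\<close> is
  orthogonal to every \<open>A z\<close>, hence to the integral itself, which forces
  \<open>w \<bullet> w = 0\<close>.\<close>

lemma integral_in_subspace:
  fixes A :: "'z \<Rightarrow> 'a::euclidean_space"
  assumes S: "subspace S" and A: "\<And>z. z \<in> space M \<Longrightarrow> A z \<in> S" and int: "integrable M A"
  shows "(LINT z|M. A z) \<in> S"
proof -
  obtain y w where yw: "y \<in> span S" "\<And>v. v \<in> span S \<Longrightarrow> orthogonal w v" "(LINT z|M. A z) = y + w"
    using orthogonal_subspace_decomp_exists[of S "LINT z|M. A z"] by metis
  have "w \<bullet> (LINT z|M. A z) = (LINT z|M. w \<bullet> A z)"
    using int by simp
  also have "\<dots> = (LINT z|M. 0)"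
    using A yw(2) by (intro Bochner_Integration.integral_cong) (auto simp: orthogonal_def span_base)
  finally have "w \<bullet> w = 0"
    using yw by (simp add: inner_add_right orthogonal_def)
  then show ?thesis using yw(1,3) S by (simp add: span_eq_iff[THEN iffD2])
qed

section \<open>Gradients of the expected loss\<close>

text \<open>The gradient is the adjoint of the derivative applied to 1.\<close>

lemma differentiable_imp_gderiv:
  fixes \<phi> :: "'a::euclidean_space \<Rightarrow> real"
  assumes "\<phi> differentiable (at u)"
  obtains c where "GDERIV \<phi> u :> c"
proof -
  obtain \<phi>' where \<phi>': "(\<phi> has_derivative \<phi>') (at u)"
    using assms unfolding differentiable_def by blast
  then have "linear \<phi>'" by (rule has_derivative_linear)
  then have "\<phi>' = (\<lambda>h. h \<bullet> adjoint \<phi>' 1)" by (auto simp: adjoint_works)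
  then show ?thesis using \<phi>' that unfolding gderiv_def by metis
qed

text \<open>The Leibniz rule is applied twice, in the parameter and in the real variable \<epsilon>;
  both times the derivative of the integrand pairs the same \<open>A z\<close> with the direction,
  so one vector \<open>G\<close> gives both gradients. Its membership in the feature space is
  recorded for the later norm computation.\<close>

lemma functional_and_parameter_gradient:
  fixes f :: "real^'p \<Rightarrow> 'x \<Rightarrow> real^'d"
  assumes f: "\<And>x. (\<lambda>\<theta>'. f \<theta>' x) differentiable (at \<theta>)"
    and rkhs: "rkhs (ntk f \<theta>) H ip"
    and C: "\<And>x y. (x, y) \<in> space D \<Longrightarrow> (\<lambda>u. C u y) differentiable (at (f \<theta> x))"
    and int: "integrable D (\<lambda>(x, y). C (f \<theta> x) y)"
    and dom_\<theta>: "dominated_increments_at D (\<lambda>\<theta>' (x, y). C (f \<theta>' x) y) \<theta>"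
    and dom_H: "\<And>g. g \<in> H \<Longrightarrow>
      dominated_increments_at D (\<lambda>\<epsilon> (x, y). C (f \<theta> x + \<epsilon> *\<^sub>R g x) y) (0::real)"
  obtains G where "G \<in> feature_space (param_jacobian f \<theta>)"
    and "GDERIV (\<lambda>\<theta>'. expected_loss C D (f \<theta>')) \<theta> :> G"
    and "has_functional_gradient H ip (expected_loss C D) (f \<theta>) (\<lambda>x. param_jacobian f \<theta> x *v G)"
proof -
  interpret rkhs "ntk f \<theta>" H ip by (rule rkhs)
  let ?J = "param_jacobian f \<theta>"
  have K: "ntk f \<theta> = (\<lambda>x x'. ?J x ** transpose (?J x'))"
    by (simp add: fun_eq_iff ntk_def)
  have J: "((\<lambda>\<theta>'. f \<theta>' x) has_derivative (\<lambda>h. ?J x *v h)) (at \<theta>)" for x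
    using f[of x] unfolding param_jacobian_def by (simp add: jacobian_works)
  \<comment> \<open>The gradients are chosen pointwise, without measurability in \<open>z\<close>;
    integrability of \<open>A\<close> comes from the domination in the parameter.\<close>
  have "\<exists>c. \<forall>z\<in>space D. GDERIV (\<lambda>u. C u (snd z)) (f \<theta> (fst z)) :> c z"
    using C by (intro bchoice ballI) (metis differentiable_imp_gderiv prod.collapse)
  then obtain c where
    c: "\<And>z. z \<in> space D \<Longrightarrow> GDERIV (\<lambda>u. C u (snd z)) (f \<theta> (fst z)) :> c z" by blast
  define A where "A z = transpose (?J (fst z)) *v c z" for z
  have "GDERIV (\<lambda>\<theta>'. case z of (x, y) \<Rightarrow> C (f \<theta>' x) y) \<theta> :> A z" if z: "z \<in> space D" for z
  proof -
    have "((\<lambda>\<theta>'. C (f \<theta>' (fst z)) (snd z)) has_derivative (\<lambda>h. (?J (fst z) *v h) \<bullet> c z)) (at \<theta>)"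
      using c[OF z] unfolding gderiv_def by (rule has_derivative_compose[OF J])
    then show ?thesis
      by (simp add: gderiv_def A_def case_prod_beta inner_vector_matrix_mult_left
          inner_commute[of _ "c z v* _"])
  qed
  note grad = dominated_increments_gradient[OF dom_\<theta> int this]
  define G where "G = (LINT z|D. A z)"
  have G: "GDERIV (\<lambda>\<theta>'. expected_loss C D (f \<theta>')) \<theta> :> G"
    using grad(2) by (simp add: expected_loss_def G_def)
  have G_in: "G \<in> feature_space ?J"
    unfolding G_def using grad(1)
    by (intro integral_in_subspace)
      (auto simp: A_def transpose_in_feature_space subspace_feature_space simp del: transpose_matrix_vector)
  have "((\<lambda>\<epsilon>. (expected_loss C D (\<lambda>x. f \<theta> x + \<epsilon> *\<^sub>R g x) - expected_loss C D (f \<theta>)) / \<epsilon>)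
      \<longlongrightarrow> ip (\<lambda>x. ?J x *v G) g) (at 0)" if g: "g \<in> H" for g
  proof -
    obtain w where w: "g = (\<lambda>x. ?J x *v w)" using feature_map_surj[OF K g] .
    have "GDERIV (\<lambda>\<epsilon>. case z of (x, y) \<Rightarrow> C (f \<theta> x + \<epsilon> *\<^sub>R g x) y) 0 :> A z \<bullet> w"
      if z: "z \<in> space D" for z
    proof -
      have "((\<lambda>u. C u (snd z)) has_derivative (\<lambda>h. h \<bullet> c z)) (at (f \<theta> (fst z) + 0 *\<^sub>R g (fst z)))"
        using c[OF z] by (simp add: gderiv_def)
      moreover have "((\<lambda>\<epsilon>. f \<theta> (fst z) + \<epsilon> *\<^sub>R g (fst z)) has_derivative (\<lambda>\<epsilon>. \<epsilon> *\<^sub>R g (fst z)))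
          (at (0::real))"
        by (auto intro!: derivative_eq_intros)
      ultimately have "((\<lambda>\<epsilon>. C (f \<theta> (fst z) + \<epsilon> *\<^sub>R g (fst z)) (snd z)) has_derivative
          (\<lambda>\<epsilon>. (\<epsilon> *\<^sub>R g (fst z)) \<bullet> c z)) (at 0)"
        by (rule has_derivative_compose[rotated])
      then show ?thesis
        by (simp add: gderiv_def w A_def inner_vector_matrix_mult_left case_prod_beta
            has_field_derivative_def mult_commute_abs)
    qed
    from dominated_increments_gradient(2)[OF dom_H[OF g] _ this] int
    have "GDERIV (\<lambda>\<epsilon>. expected_loss C D (\<lambda>x. f \<theta> x + \<epsilon> *\<^sub>R g x)) 0 :> (LINT z|D. A z \<bullet> w)"
      by (simp add: expected_loss_def)
    \<comment> \<open>Pulling \<open>w\<close> out of the integral leaves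
      \<open>G \<bullet> w\<close>. Here \<open>w\<close> is an arbitrary preimage of
      \<open>g\<close>, and it is \<open>G\<close> that lies in the feature space.\<close>
    moreover have "(LINT z|D. A z \<bullet> w) = ip (\<lambda>x. ?J x *v G) g"
      using feature_map_in_and_inner[OF K G_in, of w] g grad(1) by (simp add: w G_def)
    ultimately show ?thesis
      \<comment> \<open>Over the reals the gradient is the ordinary derivative, whose difference
        quotient at 0 is the one defining the functional gradient.\<close>
      by (simp add: gderiv_def mult_commute_abs has_field_derivative_def[symmetric] DERIV_def)
  qed
  then have "has_functional_gradient H ip (expected_loss C D) (f \<theta>) (\<lambda>x. ?J x *v G)"
    unfolding has_functional_gradient_def using feature_map_in[OF K G_in] by blast
  with G_in G show ?thesis by (rule that)
qed

theorem theorem2: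
  fixes f :: "real^'p \<Rightarrow> 'x \<Rightarrow> real^'d"
    and \<theta> :: "real^'p"
    and C :: "real^'d \<Rightarrow> 'y \<Rightarrow> real"
    and T :: "'m measure"
    and D :: "'m \<Rightarrow> ('x \<times> 'y) measure"
    and H :: "('x \<Rightarrow> real^'d) set"
    and ip :: "('x \<Rightarrow> real^'d) \<Rightarrow> ('x \<Rightarrow> real^'d) \<Rightarrow> real"
    and \<alpha> :: real
  defines "L \<equiv> \<lambda>m. expected_loss C (D m)"
  assumes "prob_space T"
    and "\<And>m. m \<in> space T \<Longrightarrow> prob_space (D m)"
    and "\<And>x. (\<lambda>\<theta>'. f \<theta>' x) differentiable (at \<theta>)"
    and "rkhs (ntk f \<theta>) H ip"
    and "\<And>m x y. \<lbrakk>m \<in> space T; (x, y) \<in> space (D m)\<rbrakk> \<Longrightarrow>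
           (\<lambda>u. C u y) differentiable (at (f \<theta> x))"
    and "\<And>m. m \<in> space T \<Longrightarrow> integrable (D m) (\<lambda>(x, y). C (f \<theta> x) y)"
    and "\<And>m. m \<in> space T \<Longrightarrow>
           dominated_increments_at (D m) (\<lambda>\<theta>' (x, y). C (f \<theta>' x) y) \<theta>"
    and "\<And>m g. \<lbrakk>m \<in> space T; g \<in> H\<rbrakk> \<Longrightarrow>
           dominated_increments_at (D m) (\<lambda>\<epsilon> (x, y). C (f \<theta> x + \<epsilon> *\<^sub>R g x) y) (0::real)"
  shows "meta_objective T L f \<alpha> \<theta> 1 = regularized_energy T L H ip \<alpha> (f \<theta>) \<and>
         (\<forall>m\<in>space T. (hnorm ip (functional_gradient H ip (L m) (f \<theta>)))\<^sup>2 =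
            (norm (param_gradient (\<lambda>\<theta>'. L m (f \<theta>')) \<theta>))\<^sup>2)"
proof -
  have norms: "(hnorm ip (functional_gradient H ip (L m) (f \<theta>)))\<^sup>2 =
      (norm (param_gradient (\<lambda>\<theta>'. L m (f \<theta>')) \<theta>))\<^sup>2" if m: "m \<in> space T" for m
  proof -
    interpret rkhs "ntk f \<theta>" H ip by fact
    obtain G where G: "G \<in> feature_space (param_jacobian f \<theta>)"
        "GDERIV (\<lambda>\<theta>'. L m (f \<theta>')) \<theta> :> G"
        "has_functional_gradient H ip (L m) (f \<theta>) (\<lambda>x. param_jacobian f \<theta> x *v G)"
      unfolding L_def
      using functional_and_parameter_gradient[OF assms(4,5) assms(6)[OF m] assms(7)[OF m]
          assms(8)[OF m] assms(9)[OF m]] by blast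
    have K: "ntk f \<theta> = (\<lambda>x x'. param_jacobian f \<theta> x ** transpose (param_jacobian f \<theta> x'))"
      by (simp add: fun_eq_iff ntk_def)
    \<comment> \<open>Uniqueness resolves both definite descriptions; the isometry with
      \<open>u = w = G\<close> then gives \<open>ip\<close> the value
      \<open>G \<bullet> G\<close>.\<close>
    show ?thesis
      unfolding functional_gradient_eqI[OF G(3)] param_gradient_eqI[OF G(2)] hnorm_def
      using feature_map_in_and_inner[OF K G(1) feature_map_in[OF K G(1)]]
      by (simp add: power2_norm_eq_inner)
  qed
  \<comment> \<open>For \<open>k = 1\<close> only \<open>i = 0\<close> contributes, where the inner
    iterate is still \<theta>; the decrement is \<alpha> times the squared gradient norm, and the
    integrands agree task by task.\<close>
  moreover have "meta_objective T L f \<alpha> \<theta> 1 = regularized_energy T L H ip \<alpha> (f \<theta>)"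
    unfolding meta_objective_def regularized_energy_def
    using norms by (intro Bochner_Integration.integral_cong)
      (auto simp: loss_decrement_def power2_norm_eq_inner)
  ultimately show ?thesis by blast
qed

end
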